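(* Let $\Delta\ge 2$ be an integer. Every graph $G$ on $n\ge 1$ vertices with maximum degree $\Delta(G)\le\Delta$ has bandwidth \[ \mathrm{bw}(G)\le \frac{6n}{\log_{\Delta}(n/s(G))}. \]
   Context: The bandwidth $\mathrm{bw}(G)$ of a graph $G=(V,E)$ on $n$ vertices is the minimum positive integer $b$ such that there is a labelling of $V$ by the numbers $1,\dots,n$ (bijectively) in which the labels of any two adjacent vertices differ by at most $b$. For a real $\tfrac12\le\alpha<1$ and $s\in\mathbb N$, a set $S\subseteq V$ is an $(s,\alpha)$-separator of $G$ if there are $A,B\subseteq V$ with $V=A\,\dot\cup\, B\,\dot\cup\, S$ (disjoint union), $|S|\le s$, $|A|,|B|\le\alpha|V|$, and no edge of $G$ has one endpoint in $A$ and the other in $B$. The separation number $s(G)$ is the smallest $s$ such that every subgraph $G'$ of $G$ has an $(s,2/3)$-separator. (One always has $1\le s(G)\le n$; if $s(G)=n$ the right-hand side is read as $+\infty$.) *)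

theory Defs
  imports Complex_Main
begin

definition graph :: "'a set \<Rightarrow> ('a \<Rightarrow> 'a \<Rightarrow> bool) \<Rightarrow> bool" where
  "graph V E \<longleftrightarrow> finite V \<and> (\<forall>u v. E u v \<longrightarrow> u \<in> V \<and> v \<in> V)
     \<and> (\<forall>u v. E u v \<longrightarrow> E v u) \<and> (\<forall>u. \<not> E u u)"

definition degree :: "'a set \<Rightarrow> ('a \<Rightarrow> 'a \<Rightarrow> bool) \<Rightarrow> 'a \<Rightarrow> nat" where
  "degree V E u = card {v \<in> V. E u v}"

definition max_degree_le :: "'a set \<Rightarrow> ('a \<Rightarrow> 'a \<Rightarrow> bool) \<Rightarrow> nat \<Rightarrow> bool" where
  "max_degree_le V E d \<longleftrightarrow> (\<forall>u\<in>V. degree V E u \<le> d)"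

definition subgraph :: "'a set \<Rightarrow> ('a \<Rightarrow> 'a \<Rightarrow> bool) \<Rightarrow> 'a set \<Rightarrow> ('a \<Rightarrow> 'a \<Rightarrow> bool) \<Rightarrow> bool" where
  "subgraph V' E' V E \<longleftrightarrow> graph V' E' \<and> V' \<subseteq> V \<and> (\<forall>u v. E' u v \<longrightarrow> E u v)"

definition bandwidth :: "'a set \<Rightarrow> ('a \<Rightarrow> 'a \<Rightarrow> bool) \<Rightarrow> nat" where
  "bandwidth V E = (LEAST b. b > 0 \<and> (\<exists>f. bij_betw f V {1..card V} \<and>
      (\<forall>u v. E u v \<longrightarrow> \<bar>int (f u) - int (f v)\<bar> \<le> int b)))"

definition is_separator :: "'a set \<Rightarrow> ('a \<Rightarrow> 'a \<Rightarrow> bool) \<Rightarrow> nat \<Rightarrow> real \<Rightarrow> 'a set \<Rightarrow> bool" where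
  "is_separator V E s \<alpha> S \<longleftrightarrow> (\<exists>A B. V = A \<union> B \<union> S \<and> A \<inter> B = {} \<and> A \<inter> S = {} \<and> B \<inter> S = {}
      \<and> card S \<le> s \<and> real (card A) \<le> \<alpha> * real (card V) \<and> real (card B) \<le> \<alpha> * real (card V)
      \<and> (\<forall>a\<in>A. \<forall>b\<in>B. \<not> E a b))"

definition separation_number :: "'a set \<Rightarrow> ('a \<Rightarrow> 'a \<Rightarrow> bool) \<Rightarrow> nat" where
  "separation_number V E = (LEAST s. \<forall>V' E'. subgraph V' E' V E \<longrightarrow>
      (\<exists>S. is_separator V' E' s (2/3) S))"

end

theory Submission
  imports Defs "HOL-Library.Disjoint_Sets"
begin

text \<open>Let \<open>L = log\<^sub>\<Delta> (n/s)\<close>, where \<open>s\<close> is the separation number. For \<open>L \<le> 6\<close> the trivial bound \<open>n\<close> suffices.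
  Otherwise, separating repeatedly yields a set \<open>S\<close> of at most \<open>3sn/\<beta>\<close> vertices, \<open>\<beta> = cn/L\<close>, whose
  removal leaves pieces of at most \<open>\<beta>\<close> vertices. Distribute the pieces evenly over \<open>r = \<Theta>(L)\<close> consecutive
  bins, but move a vertex that is closer to \<open>S\<close> than the index of its bin forward to the position given by its
  distance. Edges then only join neighbouring positions, and few vertices are moved because \<open>S\<close>
  is small and the degrees are bounded. For \<open>\<Delta> = 2\<close> the layers around \<open>S\<close> do not grow, and the
  constants differ: \<open>c = 5/2\<close>, \<open>r = \<lceil>2L\<rceil>\<close>, against \<open>c = 3/2\<close>, \<open>r = \<lceil>L/3\<rceil>\<close> for \<open>\<Delta> \<ge> 3\<close>.\<close>

section \<open>Labellings obtained from integer keys\<close>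

text \<open>Number the vertices by increasing key, breaking ties arbitrarily: the vertices numbered
  between two neighbours then have keys between theirs. This reduces bounding the bandwidth to
  counting vertices in key intervals.\<close>

lemma bandwidth_le_keyI:
  fixes k :: "'a \<Rightarrow> nat"
  assumes "graph V E" and "b > 0"
    and card_le: "\<And>u v. E u v \<Longrightarrow> k u \<le> k v \<Longrightarrow> card {x \<in> V. k u \<le> k x \<and> k x \<le> k v} \<le> b"
  shows "bandwidth V E \<le> b"
proof -
  have fin: "finite V" and sym: "\<And>u v. E u v \<Longrightarrow> E v u" and EV: "\<And>u v. E u v \<Longrightarrow> u \<in> V \<and> v \<in> V"
    using assms(1) unfolding graph_def by blast+
  obtain g :: "'a \<Rightarrow> nat" and m where g: "g ` V = {i. i < m}" "inj_on g V"
    using finite_imp_inj_to_nat_seg[OF fin] by blast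
  \<comment> \<open>Lexicographic order by \<open>k\<close>, then \<open>g\<close>; since
    \<open>g v < m\<close>, division by \<open>m\<close> recovers both components, so
    \<open>K\<close> is injective on \<open>V\<close>.\<close>
  define K where "K v = k v * m + g v" for v
  have gm: "g v < m" if "v \<in> V" for v using g(1) that by blast
  have K_div: "K v div m = k v" "K v mod m = g v" if "v \<in> V" for v
    using gm[OF that] by (auto simp: K_def)
  have k_mono: "k x \<le> k y" if "x \<in> V" "y \<in> V" "K x \<le> K y" for x y
    using div_le_mono[OF that(3), of m] K_div that by simp
  have K_inj: "inj_on K V"
    by (intro inj_onI) (metis K_div(2) g(2) inj_onD)
  \<comment> \<open>The rank of \<open>v\<close>; it counts \<open>v\<close> itself and so starts at
    1.\<close>
  define f where "f v = card {x \<in> V. K x \<le> K v}" for v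
  have f_less: "f x < f y" if "y \<in> V" "K x < K y" for x y
    unfolding f_def
  proof (rule psubset_card_mono)
    show "{z \<in> V. K z \<le> K x} \<subset> {z \<in> V. K z \<le> K y}"
      using that by (intro psubsetI) (auto simp: set_eq_iff not_le intro!: exI[of _ y])
  qed (simp add: fin)
  have f_inj: "inj_on f V"
    by (intro inj_onI) (metis K_inj f_less inj_onD less_irrefl linorder_neqE_nat)
  have "f v \<in> {1..card V}" if "v \<in> V" for v
  proof -
    have "{x \<in> V. K x \<le> K v} \<noteq> {}" using that by blast
    then have "f v > 0" unfolding f_def using fin by (simp add: card_gt_0_iff)
    moreover have "f v \<le> card V" unfolding f_def using fin by (intro card_mono) auto
    ultimately show ?thesis by simp
  qed
  then have "f ` V = {1..card V}"
    using fin f_inj by (intro card_subset_eq) (auto simp: card_image)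
  then have bij: "bij_betw f V {1..card V}" using f_inj by (simp add: bij_betw_def)
  have diff: "\<bar>int (f u) - int (f v)\<bar> \<le> int b" if "E u v" "K u \<le> K v" for u v
  proof -
    have uv: "u \<in> V" "v \<in> V" using EV that(1) by auto
    \<comment> \<open>A vertex ranked up to \<open>v\<close> is either ranked up to \<open>u\<close>
      or has its key between \<open>k u\<close> and \<open>k v\<close>.\<close>
    have "f v \<le> card ({x \<in> V. K x \<le> K u} \<union> {x \<in> V. k u \<le> k x \<and> k x \<le> k v})"
      unfolding f_def
      by (intro card_mono) (use fin uv k_mono in \<open>auto simp: not_le intro: k_mono less_imp_le\<close>)
    also have "\<dots> \<le> f u + card {x \<in> V. k u \<le> k x \<and> k x \<le> k v}"
      unfolding f_def by (rule card_Un_le)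
    also have "\<dots> \<le> f u + b"
      using card_le[OF that(1) k_mono[OF uv that(2)]] by simp
    finally have "f v \<le> f u + b" .
    moreover have "f u \<le> f v"
      unfolding f_def using that fin by (intro card_mono) auto
    ultimately show ?thesis by simp
  qed
  have "\<bar>int (f u) - int (f v)\<bar> \<le> int b" if "E u v" for u v
    using diff[of u v] diff[of v u] sym[OF that] that by linarith
  then show ?thesis
    unfolding bandwidth_def using bij \<open>b > 0\<close> by (intro Least_le) blast
qed

lemma bandwidth_le_card:
  assumes "graph V E" "card V \<ge> 1"
  shows "bandwidth V E \<le> card V"
  using assms by (intro bandwidth_le_keyI[where k = "\<lambda>_. 0"]) auto

section \<open>Separation into small pieces and their distribution over bins\<close>

text \<open>The \<open>LEAST\<close> is attained: size \<open>card V\<close> lets each subgraph use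
  its whole vertex set as separator, with both sides empty.\<close>

lemma separation_number_separates:
  assumes "graph V E" "subgraph V' E' V E"
  shows "\<exists>S. is_separator V' E' (separation_number V E) (2/3) S"
proof -
  have fin: "finite V" using assms(1) by (simp add: graph_def)
  have "is_separator W F (card V) (2/3) W" if "subgraph W F V E" for W F
    unfolding is_separator_def
    by (rule exI[of _ "{}"], rule exI[of _ "{}"])
       (use that card_mono[OF fin] in \<open>auto simp: subgraph_def\<close>)
  then have "\<forall>V' E'. subgraph V' E' V E \<longrightarrow>
      (\<exists>S. is_separator V' E' (separation_number V E) (2/3) S)"
    unfolding separation_number_def
    by (intro LeastI[of "\<lambda>s. \<forall>V' E'. subgraph V' E' V E \<longrightarrow> (\<exists>S. is_separator V' E' s (2/3) S)" "card V"]) blast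
  then show ?thesis using assms(2) by blast
qed

text \<open>In a one-vertex subgraph, a side of at most 2/3 of a vertex is empty, so the vertex must
  lie in the separator. This makes the quotient n/s meaningful.\<close>

lemma separation_number_pos:
  assumes "graph V E" "card V \<ge> 1"
  shows "separation_number V E \<ge> 1"
proof -
  have fin: "finite V" using assms(1) by (simp add: graph_def)
  obtain v where v: "v \<in> V" using assms(2) by fastforce
  have "subgraph {v} (\<lambda>_ _. False) V E"
    using v by (auto simp: subgraph_def graph_def)
  from separation_number_separates[OF assms(1) this]
  obtain S A B where *: "{v} = A \<union> B \<union> S" "card S \<le> separation_number V E"
    "real (card A) \<le> 2/3" "real (card B) \<le> 2/3"
    unfolding is_separator_def by auto
  have finAB: "finite A" "finite B" "finite S"
    using *(1) by (metis finite.emptyI finite.insertI finite_Un)+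
  have "card A = 0" "card B = 0" using *(3,4) by linarith+
  then have "S = {v}" using *(1) finAB by auto
  then show ?thesis using *(2) by simp
qed

text \<open>Every split of a set of \<open>m > \<beta>\<close> vertices either produces two parts of more than \<open>\<beta>\<close> vertices,
  or reduces the number of vertices in such parts by at least \<open>m/3 > \<beta>/3\<close>. This is why
  \<open>3m/\<beta> - 2\<close> splits suffice.\<close>

lemma separator_decomposition:
  fixes \<beta> :: real
  assumes "graph V E" "\<beta> > 0" "W \<subseteq> V"
  shows "\<exists>S P. S \<subseteq> W \<and> partition_on (W - S) P \<and> (\<forall>p\<in>P. real (card p) \<le> \<beta>) \<and>
    (\<forall>p\<in>P. \<forall>q\<in>P. p \<noteq> q \<longrightarrow> (\<forall>u\<in>p. \<forall>v\<in>q. \<not> E u v)) \<and>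
    (if real (card W) \<le> \<beta> then S = {}
     else real (card S) \<le> real (separation_number V E) * (3 * real (card W) / \<beta> - 2))"
  (is "\<exists>S P. ?Q W S P")
  using assms(3)
proof (induction "card W" arbitrary: W rule: less_induct)
  case less
  have "finite V" using assms(1) by (simp add: graph_def)
  then have fin: "finite W" using less.prems finite_subset by blast
  show ?case
  proof (cases "real (card W) \<le> \<beta>")
    case True
    \<comment> \<open>\<open>partition_on\<close> forbids empty blocks, hence the case
      distinction.\<close>
    then have "?Q W {} (if W = {} then {} else {W})"
      by (cases "W = {}") (simp_all add: partition_on_space partition_on_empty)
    then show ?thesis by (intro exI)
  next
    case False
    define m where "m = real (card W)"
    define s where "s = real (separation_number V E)"
    have m: "m > \<beta>" using False by (simp add: m_def)
    have sym: "E u v \<longleftrightarrow> E v u" and irrefl: "\<not> E u u" for u v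
      using assms(1) unfolding graph_def by metis+
    \<comment> \<open>The induced subgraph is separated, so that sides without edges between them
      there have none in \<open>E\<close> either.\<close>
    have "subgraph W (\<lambda>u v. E u v \<and> u \<in> W \<and> v \<in> W) V E"
      using less.prems fin by (simp add: subgraph_def graph_def irrefl sym)
    from separation_number_separates[OF assms(1) this]
    obtain T A B where T: "W = A \<union> B \<union> T" "A \<inter> B = {}" "A \<inter> T = {}" "B \<inter> T = {}"
      "card T \<le> separation_number V E" "real (card A) \<le> 2/3 * m" "real (card B) \<le> 2/3 * m"
      "\<forall>a\<in>A. \<forall>b\<in>B. \<not> E a b"
      unfolding is_separator_def m_def by auto
    have less_W: "card A < card W" "card B < card W"
      using T(6,7) m assms(2) by (auto simp: m_def)
    have sub: "A \<subseteq> V" "B \<subseteq> V" using T(1) less.prems by auto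
    obtain SA PA where "?Q A SA PA" using less.hyps[OF less_W(1) sub(1)] by (elim exE)
    then have A: "SA \<subseteq> A" "\<Union>PA = A - SA" "disjoint PA" "{} \<notin> PA" "\<forall>p\<in>PA. real (card p) \<le> \<beta>"
      "\<forall>p\<in>PA. \<forall>q\<in>PA. p \<noteq> q \<longrightarrow> (\<forall>u\<in>p. \<forall>v\<in>q. \<not> E u v)"
      "if real (card A) \<le> \<beta> then SA = {}
       else real (card SA) \<le> s * (3 * real (card A) / \<beta> - 2)"
      unfolding partition_on_def s_def by simp_all
    obtain SB PB where "?Q B SB PB" using less.hyps[OF less_W(2) sub(2)] by (elim exE)
    then have B: "SB \<subseteq> B" "\<Union>PB = B - SB" "disjoint PB" "{} \<notin> PB" "\<forall>p\<in>PB. real (card p) \<le> \<beta>"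
      "\<forall>p\<in>PB. \<forall>q\<in>PB. p \<noteq> q \<longrightarrow> (\<forall>u\<in>p. \<forall>v\<in>q. \<not> E u v)"
      "if real (card B) \<le> \<beta> then SB = {}
       else real (card SB) \<le> s * (3 * real (card B) / \<beta> - 2)"
      unfolding partition_on_def s_def by simp_all
    let ?S = "T \<union> SA \<union> SB"
    have card_AB: "real (card A) + real (card B) \<le> m"
    proof -
      have "card A + card B = card (A \<union> B)"
        using T fin by (subst card_Un_disjoint) auto
      also have "\<dots> \<le> card W" using T(1) fin by (intro card_mono) auto
      finally show ?thesis by (simp add: m_def)
    qed
    have "?S \<subseteq> W" using A(1) B(1) T(1) by blast
    moreover have "partition_on (W - ?S) (PA \<union> PB)"
    proof -
      have "W - ?S = (A - SA) \<union> (B - SB)" using A(1) B(1) T(1-4) by blast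
      moreover have "disjoint (PA \<union> PB)"
        using A(2,3) B(2,3) T(2) by (intro disjoint_union) auto
      ultimately show ?thesis using A(2,4) B(2,4) unfolding partition_on_def by auto
    qed
    moreover have "\<forall>p\<in>PA \<union> PB. real (card p) \<le> \<beta>" using A(5) B(5) by blast
    moreover have "\<forall>p\<in>PA \<union> PB. \<forall>q\<in>PA \<union> PB. p \<noteq> q \<longrightarrow> (\<forall>u\<in>p. \<forall>v\<in>q. \<not> E u v)"
    proof -
      have "p \<subseteq> A" if "p \<in> PA" for p using A(2) that by blast
      moreover have "p \<subseteq> B" if "p \<in> PB" for p using B(2) that by blast
      ultimately have cross: "\<not> E u v" "\<not> E v u" if "p \<in> PA" "q \<in> PB" "u \<in> p" "v \<in> q" for p q u v
        using that T(8) sym[of v u] by blast+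
      show ?thesis
      proof (intro ballI impI)
        fix p q u v
        assume pq: "p \<in> PA \<union> PB" "q \<in> PA \<union> PB" "p \<noteq> q" "u \<in> p" "v \<in> q"
        then consider "p \<in> PA" "q \<in> PA" | "p \<in> PB" "q \<in> PB" | "p \<in> PA" "q \<in> PB" | "p \<in> PB" "q \<in> PA"
          by blast
        then show "\<not> E u v"
        proof cases
          case 1
          then show ?thesis using A(6) pq(3-5) by blast
        next
          case 2
          then show ?thesis using B(6) pq(3-5) by blast
        next
          case 3
          then show ?thesis using cross(1) pq(4,5) by blast
        next
          case 4
          then show ?thesis using cross(2) pq(4,5) by blast
        qed
      qed
    qed
    moreover have "real (card ?S) \<le> s * (3 * m / \<beta> - 2)"
    proof -
      have s0: "s \<ge> 0" by (simp add: s_def)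
      \<comment> \<open>The number of splits charged to each side; a side of at most \<beta>
        vertices is left whole and costs nothing.\<close>
      define a where "a = (if real (card A) \<le> \<beta> then 0 else 3 * real (card A) / \<beta> - 2)"
      define b where "b = (if real (card B) \<le> \<beta> then 0 else 3 * real (card B) / \<beta> - 2)"
      have SA: "real (card SA) \<le> s * a" and SB: "real (card SB) \<le> s * b"
        using A(7) B(7) by (auto simp: a_def b_def split: if_splits)
      have "card ?S \<le> card T + card SA + card SB"
        using card_Un_le[of "T \<union> SA" SB] card_Un_le[of T SA] by linarith
      then have "real (card ?S) \<le> real (card T) + real (card SA) + real (card SB)" by linarith
      also have "\<dots> \<le> s + s * a + s * b"
        using T(5) SA SB by (simp add: s_def)
      also have "\<dots> = s * (1 + a + b)" by (simp add: algebra_simps)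
      also have "\<dots> \<le> s * (3 * m / \<beta> - 2)"
      proof (intro mult_left_mono s0)
        \<comment> \<open>If both sides are large, their two terms -2 pay for the new split. If one
          is, its share 2m/3 gives at most 2m/\<beta> - 1, and m > \<beta> suffices. If none is, 1
          \<le> 3m/\<beta> - 2.\<close>
        have "m / \<beta> > 1" using m assms(2) by simp
        moreover have "real (card A) / \<beta> \<le> 2/3 * (m / \<beta>)" "real (card B) / \<beta> \<le> 2/3 * (m / \<beta>)"
          using T(6,7) assms(2) by (auto simp: field_simps)
        moreover have "real (card A) / \<beta> + real (card B) / \<beta> \<le> m / \<beta>"
          using divide_right_mono[OF card_AB, of \<beta>] assms(2) by (simp add: add_divide_distrib)
        ultimately show "1 + a + b \<le> 3 * m / \<beta> - 2"
          by (auto simp: a_def b_def)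
      qed
      finally show ?thesis .
    qed
    ultimately have "?Q W ?S (PA \<union> PB)" using False by (simp add: m_def s_def)
    then show ?thesis by (intro exI)
  qed
qed

text \<open>Greedily put each item into a bin of least load.\<close>

lemma balanced_assignment:
  fixes size :: "'b \<Rightarrow> real" and r :: nat
  assumes "finite P" "\<And>p. p \<in> P \<Longrightarrow> 0 \<le> size p \<and> size p \<le> \<beta>" "\<beta> \<ge> 0" "r \<ge> 1"
  shows "\<exists>g. (\<forall>p. g p \<in> {1..r}) \<and>
    (\<forall>q\<in>{1..r}. sum size {p \<in> P. g p = q} \<le> sum size P / real r + \<beta>)"
  using assms(1,2)
proof (induction P rule: finite_induct)
  case empty
  then show ?case using assms(3,4) by (intro exI[of _ "\<lambda>_. 1"]) auto
next
  case (insert x P)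
  have "\<exists>g. (\<forall>p. g p \<in> {1..r}) \<and>
      (\<forall>q\<in>{1..r}. sum size {p \<in> P. g p = q} \<le> sum size P / real r + \<beta>)"
    by (rule insert.IH) (simp add: insert.prems)
  then obtain g where g: "\<And>p. g p \<in> {1..r}"
    "\<And>q. q \<in> {1..r} \<Longrightarrow> sum size {p \<in> P. g p = q} \<le> sum size P / real r + \<beta>"
    by blast
  define load where "load q = sum size {p \<in> P. g p = q}" for q
  have tot: "(\<Sum>q\<in>{1..r}. load q) = sum size P"
    unfolding load_def using g(1) insert.hyps(1) by (intro sum.group) auto
  \<comment> \<open>Averaging: if all loads exceeded the mean, their sum would exceed the
    total.\<close>
  have "\<exists>q\<in>{1..r}. load q \<le> sum size P / real r"
  proof (rule ccontr)
    assume "\<not> ?thesis"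
    then have "sum size P / real r < load q" if "q \<in> {1..r}" for q
      using that by (meson not_le)
    then have "(\<Sum>q\<in>{1..r}. sum size P / real r) < (\<Sum>q\<in>{1..r}. load q)"
      using assms(4) by (intro sum_strict_mono) auto
    then show False using tot assms(4) by simp
  qed
  then obtain q0 where q0: "q0 \<in> {1..r}" "load q0 \<le> sum size P / real r" by blast
  have x: "0 \<le> size x" "size x \<le> \<beta>" using insert.prems by auto
  have sum_mono: "sum size P / real r \<le> sum size (insert x P) / real r"
    using insert.hyps x by (intro divide_right_mono) auto
  have "sum size {p \<in> insert x P. (g(x := q0)) p = q} \<le> sum size (insert x P) / real r + \<beta>"
    if q: "q \<in> {1..r}" for q
  proof (cases "q = q0")
    case True
    then have "{p \<in> insert x P. (g(x := q0)) p = q} = insert x {p \<in> P. g p = q0}"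
      using insert.hyps by auto
    then have "sum size {p \<in> insert x P. (g(x := q0)) p = q} = size x + load q0"
      using insert.hyps by (simp add: load_def)
    then show ?thesis using x q0 sum_mono by linarith
  next
    case False
    then have "{p \<in> insert x P. (g(x := q0)) p = q} = {p \<in> P. g p = q}"
      using insert.hyps by auto
    then have "sum size {p \<in> insert x P. (g(x := q0)) p = q} = sum size {p \<in> P. g p = q}"
      by (rule arg_cong)
    then show ?thesis using g(2)[OF q] sum_mono by linarith
  qed
  then show ?case using g(1) q0(1) by (intro exI[of _ "g(x := q0)"]) auto
qed

section \<open>Layers around the separator and the resulting labelling\<close>

text \<open>The ball of radius i around \<open>S\<close>.\<close>

primrec reach :: "('a \<Rightarrow> 'a \<Rightarrow> bool) \<Rightarrow> 'a set \<Rightarrow> nat \<Rightarrow> 'a set" where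
  "reach E S 0 = S"
| "reach E S (Suc i) = reach E S i \<union> {v. \<exists>u\<in>reach E S i. E u v}"

text \<open>The sphere: the vertices at distance exactly i from \<open>S\<close>.\<close>

primrec layer :: "('a \<Rightarrow> 'a \<Rightarrow> bool) \<Rightarrow> 'a set \<Rightarrow> nat \<Rightarrow> 'a set" where
  "layer E S 0 = S"
| "layer E S (Suc i) = reach E S (Suc i) - reach E S i"

lemma reach_subset:
  assumes "graph V E" "S \<subseteq> V"
  shows "reach E S i \<subseteq> V"
  by (induction i) (use assms in \<open>auto simp: graph_def\<close>)

lemma layer_subset:
  assumes "graph V E" "S \<subseteq> V"
  shows "layer E S i \<subseteq> V"
  using reach_subset[OF assms] assms(2) by (cases i) (auto simp del: reach.simps)

lemma card_UN_le_mult: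
  assumes "finite I" "\<And>i. i \<in> I \<Longrightarrow> card (f i) \<le> m"
  shows "card (\<Union>i\<in>I. f i) \<le> card I * m"
proof -
  have "card (\<Union>i\<in>I. f i) \<le> (\<Sum>i\<in>I. card (f i))" by (rule card_UN_le[OF assms(1)])
  also have "\<dots> \<le> card I * m" using sum_bounded_above[of I "\<lambda>i. card (f i)" m] assms(2) by simp
  finally show ?thesis .
qed

text \<open>A vertex outside \<open>S\<close> in a layer has a neighbour one step nearer to
  \<open>S\<close>, leaving at most \<open>\<Delta> - 1\<close> neighbours in the next layer; only
  the vertices of \<open>S\<close> may spend all \<Delta>. For \<Delta> = 2 this keeps the layers
  bounded.\<close>

lemma card_layer_le:
  assumes "graph V E" "max_degree_le V E \<Delta>" "S \<subseteq> V"
  shows "card (layer E S (Suc i)) \<le> card S * \<Delta> * (\<Delta> - 1) ^ i"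
proof (induction i)
  have fin: "finite V" using assms(1) by (simp add: graph_def)
  have deg: "card {v \<in> V. E u v} \<le> \<Delta>" if "u \<in> V" for u
    using assms(2) that by (simp add: max_degree_le_def degree_def)
  have sym: "\<And>u v. E u v \<Longrightarrow> E v u" and EV: "\<And>u v. E u v \<Longrightarrow> u \<in> V \<and> v \<in> V"
    using assms(1) unfolding graph_def by blast+
  {
    case 0
    have "card (layer E S (Suc 0)) \<le> card (\<Union>u\<in>S. {v \<in> V. E u v})"
    proof (rule card_mono)
      show "finite (\<Union>u\<in>S. {v \<in> V. E u v})" by (rule finite_subset[OF _ fin]) auto
    qed (use EV in auto)
    also have "\<dots> \<le> card S * \<Delta>"
      using deg assms(3) finite_subset[OF assms(3) fin] by (intro card_UN_le_mult) auto
    finally show ?case by simp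
  next
    case (Suc i)
    define L where "L = layer E S (Suc i)"
    have L: "L \<subseteq> V" "finite L"
      using layer_subset[OF assms(1,3), of "Suc i"] fin finite_subset by (auto simp: L_def simp del: layer.simps)
    \<comment> \<open>A predecessor of \<open>v\<close> lies in the layer just before: if it were in
      \<open>reach E S i\<close>, then \<open>v\<close> would be in
      \<open>reach E S (Suc i)\<close>.\<close>
    have step: "\<exists>u\<in>L. v \<in> {v \<in> V. E u v} - reach E S i" if v: "v \<in> layer E S (Suc (Suc i))" for v
    proof -
      obtain u where u: "u \<in> reach E S (Suc i)" "E u v" and "v \<notin> reach E S (Suc i)"
        using v by auto
      then have "u \<notin> reach E S i" "v \<notin> reach E S i" by auto
      then show ?thesis using u EV by (auto simp: L_def)
    qed
    have "card (layer E S (Suc (Suc i))) \<le> card (\<Union>u\<in>L. {v \<in> V. E u v} - reach E S i)"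
    proof (rule card_mono)
      show "finite (\<Union>u\<in>L. {v \<in> V. E u v} - reach E S i)" by (rule finite_subset[OF _ fin]) auto
    qed (use step in blast)
    also have "\<dots> \<le> card L * (\<Delta> - 1)"
    proof (rule card_UN_le_mult[OF L(2)])
      fix u assume u: "u \<in> L"
      then obtain w where w: "w \<in> reach E S i" "E w u" by (auto simp: L_def)
      have "card ({v \<in> V. E u v} - reach E S i) \<le> card ({v \<in> V. E u v} - {w})"
        using fin w by (intro card_mono) auto
      also have "\<dots> = card {v \<in> V. E u v} - 1"
        using w sym EV by (intro card_Diff_singleton) auto
      finally show "card ({v \<in> V. E u v} - reach E S i) \<le> \<Delta> - 1"
        using deg[of u] u L(1) by force
    qed
    also have "\<dots> \<le> card S * \<Delta> * (\<Delta> - 1) ^ i * (\<Delta> - 1)"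
      using Suc.IH unfolding L_def by (intro mult_right_mono) auto
    finally show ?case by (simp only: power_Suc2 mult.assoc)
  }
qed

text \<open>With the pieces distributed over \<open>r\<close> bins, the vertices are labelled in the order
  \<open>D\<^sub>0, C\<^sub>1, D\<^sub>1, C\<^sub>2, D\<^sub>2, \<dots>, C\<^sub>r\<close>, where \<open>D\<^sub>i\<close> consists of the vertices at distance \<open>i\<close>
  from \<open>S\<close> whose bin has an index above \<open>i\<close>, and \<open>C\<^sub>j\<close> of the remaining vertices of bin \<open>j\<close>.
  Every edge stays within some \<open>D\<^sub>i \<union> C\<^sub>i\<^sub>+\<^sub>1 \<union> D\<^sub>i\<^sub>+\<^sub>1\<close>.\<close>

lemma bandwidth_le_decomposition:
  fixes \<beta> M :: real and r :: nat
  assumes graph: "graph V E" and S: "S \<subseteq> V" and P: "partition_on (V - S) P"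
    and small: "\<And>p. p \<in> P \<Longrightarrow> real (card p) \<le> \<beta>"
    and no_edge: "\<And>p q u v. p \<in> P \<Longrightarrow> q \<in> P \<Longrightarrow> p \<noteq> q \<Longrightarrow> u \<in> p \<Longrightarrow> v \<in> q \<Longrightarrow> \<not> E u v"
    and "r \<ge> 1" "\<beta> \<ge> 1"
    and M: "\<And>i. i < r \<Longrightarrow>
      real (card (layer E S i)) + (if Suc i < r then real (card (layer E S (Suc i))) else 0) \<le> M"
  shows "real (bandwidth V E) \<le> real (card V) / real r + \<beta> + M"
proof -
  define T where "T = real (card V) / real r + \<beta> + M"
  have fin: "finite V" and sym: "\<And>u v. E u v \<Longrightarrow> E v u" and EV: "\<And>u v. E u v \<Longrightarrow> u \<in> V \<and> v \<in> V"
    using graph unfolding graph_def by blast+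
  have finP: "finite P" using finite_elements[OF _ P] fin by simp
  have UP: "\<Union>P = V - S" and disj: "disjoint P" using P by (auto simp: partition_on_def)
  have fin_p: "finite p" if "p \<in> P" for p
    using that UP fin by (metis Union_upper finite_Diff finite_subset)
  have "\<exists>g. (\<forall>p. g p \<in> {1..r}) \<and> (\<forall>q\<in>{1..r}.
      (\<Sum>p\<in>{p \<in> P. g p = q}. real (card p)) \<le> (\<Sum>p\<in>P. real (card p)) / real r + \<beta>)"
    using assms(6,7) by (intro balanced_assignment finP) (simp_all add: small)
  then obtain g where g: "\<And>p. g p \<in> {1..r}"
    "\<And>q. q \<in> {1..r} \<Longrightarrow>
       (\<Sum>p\<in>{p \<in> P. g p = q}. real (card p)) \<le> (\<Sum>p\<in>P. real (card p)) / real r + \<beta>"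
    by blast
  have "(\<Sum>p\<in>P. real (card p)) = real (card (V - S))"
    using card_Union_disjoint[OF disj fin_p] UP by simp
  also have "\<dots> \<le> real (card V)" using fin by (simp add: card_mono)
  finally have sum_le: "(\<Sum>p\<in>P. real (card p)) / real r \<le> real (card V) / real r"
    by (intro divide_right_mono) auto
  \<comment> \<open>Unspecified on \<open>S\<close>, but harmless: \<open>g\<close> takes values in
    \<open>{1..r}\<close> everywhere, so the bounds on \<open>j\<close> hold for every
    vertex.\<close>
  define piece where "piece v = (THE p. p \<in> P \<and> v \<in> p)" for v
  have piece_eq: "piece v = p" if "p \<in> P" "v \<in> p" for p v
    unfolding piece_def using that disj
    by (intro the_equality) (auto dest: disjointD)
  have piece: "piece v \<in> P" "v \<in> piece v" if "v \<in> V - S" for v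
    using that UP piece_eq by (metis UnionE)+
  define j where "j v = g (piece v)" for v
  have j: "1 \<le> j v" "j v \<le> r" for v using g(1)[of "piece v"] by (auto simp: j_def)
  have bin: "real (card {v \<in> V - S. j v = q}) \<le> real (card V) / real r + \<beta>" if q: "q \<in> {1..r}" for q
  proof -
    have "real (card {v \<in> V - S. j v = q}) \<le> real (card (\<Union>p\<in>{p \<in> P. g p = q}. p))"
      unfolding of_nat_le_iff
    proof (rule card_mono)
      show "finite (\<Union>p\<in>{p \<in> P. g p = q}. p)" using finP fin_p by auto
      show "{v \<in> V - S. j v = q} \<subseteq> (\<Union>p\<in>{p \<in> P. g p = q}. p)"
        using piece unfolding j_def by blast
    qed
    also have "\<dots> \<le> (\<Sum>p\<in>{p \<in> P. g p = q}. real (card p))"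
      using card_UN_le[of "{p \<in> P. g p = q}" "\<lambda>p. p"] finP
      by (simp flip: of_nat_sum)
    also have "\<dots> \<le> real (card V) / real r + \<beta>" using g(2)[OF q] sum_le by linarith
    finally show ?thesis .
  qed
  \<comment> \<open>Distance to \<open>S\<close> truncated at \<open>r\<close>; the disjunct
    \<open>i = r\<close> also covers vertices that \<open>S\<close> does not reach.\<close>
  define d where "d v = (LEAST i. v \<in> reach E S i \<or> i = r)" for v
  have d: "v \<in> reach E S (d v) \<or> d v = r" for v
    unfolding d_def by (rule LeastI[of _ r]) simp
  have d_le: "d v \<le> i" if "v \<in> reach E S i \<or> i = r" for v i
    unfolding d_def by (rule Least_le) (rule that)
  have d_r: "d v \<le> r" for v by (rule d_le) simp
  have d_edge: "d v \<le> Suc (d u)" if "E u v" for u v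
  proof (cases "d u = r")
    case False
    then have "u \<in> reach E S (d u)" using d by blast
    then show ?thesis using that by (intro d_le) auto
  qed (use d_r[of v] in simp)
  have d_layer: "v \<in> layer E S (d v)" if "d v < r" for v
  proof (cases "d v")
    case 0
    then show ?thesis using d[of v] that by simp
  next
    case (Suc i)
    then have "v \<notin> reach E S i" using d_le[of v i] by auto
    then show ?thesis using d[of v] that Suc by simp
  qed
  have d0: "d v = 0 \<longleftrightarrow> v \<in> S" for v
  proof
    assume "d v = 0"
    then show "v \<in> S" using d[of v] assms(6) by simp
  next
    assume "v \<in> S"
    then show "d v = 0" using d_le[of v 0] by simp
  qed
  \<comment> \<open>Even keys 2i encode \<open>D\<^sub>i\<close>, odd keys 2j - 1 encode
    \<open>C\<^sub>j\<close>.\<close>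
  define key where "key v = (if d v = 0 then 0 else if d v < j v then 2 * d v else 2 * j v - 1)" for v
  have edge_key: "\<exists>i<r. 2 * i \<le> key u \<and> key v \<le> 2 * i + 2"
    if uv: "E u v" "key u \<le> key v" for u v
  proof -
    have duv: "d v \<le> Suc (d u)" "d u \<le> Suc (d v)" using d_edge[OF uv(1)] d_edge[OF sym[OF uv(1)]] by simp_all
    show ?thesis
    \<comment> \<open>An endpoint in \<open>S\<close> has no meaningful bin, but then both distances
      are at most 1 and the keys at most 2. All other edges stay inside one piece, hence one
      bin.\<close>
    proof (cases "u \<in> S \<or> v \<in> S")
      case True
      then have "d u = 0 \<or> d v = 0" using d0[of u] d0[of v] by simp
      then have "d u \<le> 1" "d v \<le> 1" using duv by auto
      then have "key v \<le> 2" using j(1)[of v] by (auto simp: key_def)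
      then show ?thesis using assms(6) by (intro exI[of _ 0]) auto
    next
      case False
      then have "u \<in> V - S" "v \<in> V - S" using EV uv(1) by auto
      then have "piece u = piece v" using piece no_edge uv(1) by metis
      then have j_eq: "j u = j v" by (simp add: j_def)
      have pos: "d u > 0" "d v > 0" using False d0 by auto
      show ?thesis
      proof (cases "d u < j u")
        case True
        then show ?thesis using pos duv j_eq j(2)[of u]
          by (intro exI[of _ "d u"]) (auto simp: key_def)
      next
        case False
        \<comment> \<open>Here \<open>u\<close> is in \<open>C\<^sub>j\<close>. A moved
          \<open>v\<close> would have key 2 \<open>d v\<close> < 2j - 1, against the order of the
          keys, so \<open>v\<close> is in \<open>C\<^sub>j\<close> too.\<close>
        then show ?thesis using pos duv j_eq j[of u] uv(2)
          by (intro exI[of _ "j u - 1"]) (auto simp: key_def split: if_splits)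
      qed
    qed
  qed
  have block: "real (card {x \<in> V. 2 * i \<le> key x \<and> key x \<le> 2 * i + 2}) \<le> T" if i: "i < r" for i
  proof -
    \<comment> \<open>\<open>D\<^sub>r\<close> is empty, since a moved vertex has distance below its
      bin index, which is at most \<open>r\<close>. Hence the last block meets only one
      layer.\<close>
    define N where "N = (if Suc i < r then layer E S (Suc i) else {})"
    have N: "real (card (layer E S i)) + real (card N) \<le> M"
      using M[OF i] by (auto simp: N_def simp del: layer.simps)
    have fin_layer: "finite (layer E S l)" for l
      using layer_subset[OF graph S] fin finite_subset by blast
    have "x \<in> layer E S i \<union> {v \<in> V - S. j v = Suc i} \<union> N"
      if x: "x \<in> V" "2 * i \<le> key x" "key x \<le> 2 * i + 2" for x
    proof (cases "d x < j x")
      case True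
      then have dr: "d x < r" using j(2)[of x] by linarith
      have "key x = 2 * d x" using True by (auto simp: key_def)
      then have "d x = i \<or> d x = Suc i" using x by linarith
      then show ?thesis using d_layer[OF dr] dr by (auto simp: N_def simp del: layer.simps)
    next
      case False
      then have "d x \<noteq> 0" using j(1)[of x] by auto
      then have "key x = 2 * j x - 1" using False by (auto simp: key_def)
      then have "j x = Suc i" using x j(1)[of x] by linarith
      then show ?thesis using x(1) d0[of x] \<open>d x \<noteq> 0\<close> by auto
    qed
    then have "card {x \<in> V. 2 * i \<le> key x \<and> key x \<le> 2 * i + 2}
        \<le> card (layer E S i \<union> {v \<in> V - S. j v = Suc i} \<union> N)"
    proof (intro card_mono)
      show "finite (layer E S i \<union> {v \<in> V - S. j v = Suc i} \<union> N)"
        using fin fin_layer by (simp add: N_def del: layer.simps)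
    qed blast
    also have "\<dots> \<le> card (layer E S i) + card {v \<in> V - S. j v = Suc i} + card N"
      using card_Un_le[of "layer E S i \<union> {v \<in> V - S. j v = Suc i}" N]
        card_Un_le[of "layer E S i" "{v \<in> V - S. j v = Suc i}"] by linarith
    finally show ?thesis using N bin[of "Suc i"] i unfolding T_def by simp
  qed
  have "M \<ge> 0" using M[of 0] assms(6) by (auto intro: order_trans[rotated] simp del: layer.simps split: if_splits)
  moreover have "real (card V) / real r \<ge> 0" by simp
  \<comment> \<open>This makes the rounded bound positive, as the definition of bandwidth
    demands.\<close>
  ultimately have T1: "T \<ge> 1" using assms(7) unfolding T_def by linarith
  have "bandwidth V E \<le> nat \<lfloor>T\<rfloor>"
  proof (rule bandwidth_le_keyI[OF graph, where k = key])
    show "nat \<lfloor>T\<rfloor> > 0" using T1 by simp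
    fix u v assume "E u v" "key u \<le> key v"
    then obtain i where i: "i < r" "2 * i \<le> key u" "key v \<le> 2 * i + 2" using edge_key by blast
    have "card {x \<in> V. key u \<le> key x \<and> key x \<le> key v}
        \<le> card {x \<in> V. 2 * i \<le> key x \<and> key x \<le> 2 * i + 2}"
      using fin i by (intro card_mono) auto
    then have "real (card {x \<in> V. key u \<le> key x \<and> key x \<le> key v}) \<le> T"
      using block[OF i(1)] by linarith
    then show "card {x \<in> V. key u \<le> key x \<and> key x \<le> key v} \<le> nat \<lfloor>T\<rfloor>" by linarith
  qed
  then show ?thesis using T1 unfolding T_def by linarith
qed

section \<open>Numerical estimates and the choice of constants\<close>

text \<open>Convexity: \<open>exp x \<ge> 1 + x\<close>, expanded around L = 6, where the right-hand
  side is 27, with ln 3 \<ge> 1 for the slope.\<close>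

lemma le_three_powr:
  fixes L :: real
  assumes "L \<ge> 6"
  shows "4 * L \<le> 3 * 3 powr (L / 3)"
proof -
  have ln3: "ln (3::real) \<ge> 1" using exp_le by (simp add: ln_ge_iff)
  have "1 + (L - 6) / 3 * 1 \<le> 1 + (L - 6) / 3 * ln 3"
    using ln3 assms by (intro add_left_mono mult_left_mono) auto
  also have "\<dots> \<le> 3 powr ((L - 6) / 3)"
    using exp_ge_add_one_self[of "(L - 6) / 3 * ln 3"] by (simp add: powr_def)
  finally have "9 * (1 + (L - 6) / 3) \<le> 9 * 3 powr ((L - 6) / 3)" by (intro mult_left_mono) auto
  also have "\<dots> = 3 powr (2 + (L - 6) / 3)" by (simp only: powr_add) simp
  also have "2 + (L - 6) / 3 = L / 3" by (simp add: field_simps)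
  finally show ?thesis using assms by (simp add: field_simps)
qed

text \<open>The square of 4L \<le> 3 * 2 powr (L/2), which is an equality at L = 6 and follows from
  there by the same expansion.\<close>

lemma square_le_two_powr:
  fixes L :: real
  assumes "L \<ge> 6"
  shows "16 * L\<^sup>2 \<le> 9 * 2 powr L"
proof -
  have "ln (3::real) \<ge> 1" using exp_le by (simp add: ln_ge_iff)
  \<comment> \<open>From e \<le> 3 \<le> 8 = 2^3, a lower bound 1/3 for ln 2.\<close>
  moreover have "ln (3::real) \<le> ln (2 ^ 3)" by simp
  ultimately have ln2: "ln (2::real) \<ge> 1/3" by (simp only: ln_realpow)
  have "1 + (L - 6) / 2 * (1/3) \<le> 1 + (L - 6) / 2 * ln 2"
    using ln2 assms by (intro add_left_mono mult_left_mono) auto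
  also have "\<dots> \<le> 2 powr ((L - 6) / 2)"
    using exp_ge_add_one_self[of "(L - 6) / 2 * ln 2"] by (simp add: powr_def)
  finally have "8 * (1 + (L - 6) / 6) \<le> 8 * 2 powr ((L - 6) / 2)" by (intro mult_left_mono) auto
  also have "\<dots> = 2 powr (3 + (L - 6) / 2)" by (simp only: powr_add) simp
  also have "3 + (L - 6) / 2 = L / 2" by (simp add: field_simps)
  finally have "4 * L \<le> 3 * 2 powr (L / 2)" using assms by (simp add: field_simps)
  then have "(4 * L)\<^sup>2 \<le> (3 * 2 powr (L / 2))\<^sup>2" using assms by (intro power_mono) auto
  also have "\<dots> = 9 * 2 powr L"
    by (simp add: power_mult_distrib power2_eq_square flip: powr_add)
  finally show ?thesis by (simp add: power_mult_distrib)
qed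

theorem theorem5:
  fixes V :: "'a set" and E :: "'a \<Rightarrow> 'a \<Rightarrow> bool" and \<Delta> :: nat
  assumes "\<Delta> \<ge> 2" and "graph V E" and "card V \<ge> 1" and "max_degree_le V E \<Delta>"
  shows "separation_number V E < card V \<longrightarrow>
    real (bandwidth V E) \<le> 6 * real (card V) /
       log (real \<Delta>) (real (card V) / real (separation_number V E))"
proof
  assume less: "separation_number V E < card V"
  define n where "n = real (card V)"
  define s where "s = real (separation_number V E)"
  define L where "L = log (real \<Delta>) (n / s)"
  have n: "n \<ge> 1" using assms(3) by (simp add: n_def)
  have s: "s \<ge> 1" "s < n"
    using separation_number_pos[OF assms(2,3)] less by (auto simp: s_def n_def)
  have L_pos: "L > 0" using assms(1) s by (simp add: L_def)
  have n_eq: "n = s * real \<Delta> powr L"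
    using assms(1) s by (simp add: L_def)
  have "real (bandwidth V E) \<le> 6 * n / L"
  proof (cases "L \<le> 6")
    case True
    have "real (bandwidth V E) \<le> n"
      using bandwidth_le_card[OF assms(2,3)] by (simp add: n_def)
    also have "n \<le> 6 * n / L" using True L_pos n by (simp add: field_simps mult_left_mono)
    finally show ?thesis .
  next
    case False
    then have L: "L \<ge> 6" by simp
    \<comment> \<open>Needed for \<beta> = cn/L to be at least 1.\<close>
    have "L \<le> n"
    proof -
      have "9 * L \<le> 16 * L * L" using L by (intro mult_right_mono) auto
      also have "\<dots> \<le> 9 * 2 powr L"
        using square_le_two_powr[OF L] by (simp add: power2_eq_square mult.assoc)
      also have "2 powr L \<le> real \<Delta> powr L" using assms(1) L by (intro powr_mono2) auto
      also have "\<dots> \<le> n" unfolding n_eq using s(1) by (simp add: mult_le_cancel_right1)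
      finally show ?thesis by simp
    qed
    \<comment> \<open>The summands are the mean load of a bin, the overflow \<beta> of a bin, and
      two successive layers: |S| \<le> 3sL/c, and \<open>K\<close> bounds their joint size per
      vertex of \<open>S\<close>.\<close>
    have main: "real (bandwidth V E) \<le> n / real r + c * n / L + 3 * s * L / c * K"
      if "c \<ge> 1" "r \<ge> 1" "K \<ge> 0" and K: "\<And>S i. S \<subseteq> V \<Longrightarrow> i < r \<Longrightarrow>
        real (card (layer E S i)) + (if Suc i < r then real (card (layer E S (Suc i))) else 0)
          \<le> real (card S) * K"
      for c K and r :: nat
    proof -
      define \<beta> where "\<beta> = c * n / L"
      have "1 * 1 \<le> c * (n / L)"
        using that(1) \<open>L \<le> n\<close> L_pos by (intro mult_mono) auto
      then have \<beta>: "\<beta> \<ge> 1" by (simp add: \<beta>_def)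
      then obtain S P where S: "S \<subseteq> V" "partition_on (V - S) P" "\<forall>p\<in>P. real (card p) \<le> \<beta>"
        "\<forall>p\<in>P. \<forall>q\<in>P. p \<noteq> q \<longrightarrow> (\<forall>u\<in>p. \<forall>v\<in>q. \<not> E u v)"
        "if n \<le> \<beta> then S = {} else real (card S) \<le> s * (3 * n / \<beta> - 2)"
        using separator_decomposition[OF assms(2), of \<beta> V] unfolding n_def s_def by auto
      have "real (card S) \<le> s * (3 * n / \<beta>)"
      proof (cases "n \<le> \<beta>")
        case False
        then have "real (card S) \<le> s * (3 * n / \<beta> - 2)" using S(5) by simp
        also have "\<dots> \<le> s * (3 * n / \<beta>)" using s(1) by (intro mult_left_mono) auto
        finally show ?thesis .
      qed (use S(5) s(1) n \<beta> in auto)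
      also have "\<dots> = 3 * s * L / c" using n L_pos that(1) by (simp add: \<beta>_def)
      finally have card_S: "real (card S) * K \<le> 3 * s * L / c * K"
        using that(3) by (rule mult_right_mono)
      have "real (bandwidth V E) \<le> n / real r + \<beta> + real (card S) * K"
        unfolding n_def using S(3,4) that(2) \<beta> K[OF S(1)]
        by (intro bandwidth_le_decomposition[OF assms(2) S(1,2)]) blast+
      then show ?thesis using card_S by (simp add: \<beta>_def)
    qed
    have layer_le: "card (layer E S (Suc i)) \<le> card S * \<Delta> * (\<Delta> - 1) ^ i" if "S \<subseteq> V" for S i
      using card_layer_le[OF assms(2,4) that] .
    show ?thesis
    proof (cases "\<Delta> = 2")
      case True
      \<comment> \<open>The budget 6 is split as 1/2 for the mean load, 5/2 for \<beta> and 3 for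
        the layers.\<close>
      define r where "r = nat \<lceil>2 * L\<rceil>"
      have r: "real r \<ge> 2 * L" "r \<ge> 1" using L unfolding r_def by linarith+
      have two_nat: "card (layer E S i) \<le> card S * 2" if "S \<subseteq> V" for S i
        using layer_le[OF that] True by (cases i) (auto simp del: layer.simps(2))
      have two: "real (card (layer E S i)) \<le> real (card S) * 2" if "S \<subseteq> V" for S i
        using of_nat_mono[OF two_nat[OF that, of i], where 'a = real] by simp
      have "real (bandwidth V E) \<le> n / real r + (5/2) * n / L + 3 * s * L / (5/2) * 4"
      proof (rule main)
        fix S i assume "S \<subseteq> V"
        then show "real (card (layer E S i)) + (if Suc i < r then real (card (layer E S (Suc i))) else 0)
            \<le> real (card S) * 4"
          using two[of S i] two[of S "Suc i"] by (simp del: layer.simps)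
      qed (use r in auto)
      also have "n / real r \<le> n / (2 * L)" using r L n by (intro divide_left_mono) auto
      also have "3 * s * L / (5/2) * 4 \<le> 3 * n / L"
      proof -
        have "s * (16 * L\<^sup>2) \<le> s * (9 * 2 powr L)"
          using square_le_two_powr[OF L] s(1) by (intro mult_left_mono) auto
        also have "\<dots> = 9 * n" using n_eq True by simp
        finally have "s * (16 * L\<^sup>2) \<le> 10 * n" using n by linarith
        then show ?thesis using L by (simp add: field_simps power2_eq_square)
      qed
      also have "n / (2 * L) + (5/2) * n / L + 3 * n / L = 6 * n / L"
        using L_pos by (simp add: field_simps)
      finally show ?thesis by simp
    next
      case False
      then have \<Delta>: "\<Delta> \<ge> 3" using assms(1) by simp
      \<comment> \<open>The budget 6 is split as 3 + 3/2 + 3/2. Only layers up to index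
        \<open>r - 1\<close> \<le> L/3 occur, so their growth is at most the cube root of
        n/s.\<close>
      define r where "r = nat \<lceil>L / 3\<rceil>"
      have r: "real r \<ge> L / 3" "real r - 1 \<le> L / 3" "r \<ge> 2" using L unfolding r_def by linarith+
      \<comment> \<open>As \<Delta> \<ge> 3, each power of \<Delta> is at most a third of the next,
        so two successive ones sum to at most 4/3 of the larger.\<close>
      define K where "K = 4/3 * real \<Delta> ^ (r - 1)"
      have layer_pow: "real (card (layer E S i)) \<le> real (card S) * real \<Delta> ^ i" if "S \<subseteq> V" for S i
      proof (cases i)
        case (Suc i')
        have "card (layer E S i) \<le> card S * \<Delta> * (\<Delta> - 1) ^ i'"
          using layer_le[OF that] Suc by simp
        also have "\<dots> \<le> card S * \<Delta> * \<Delta> ^ i'" by (intro mult_left_mono power_mono) auto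
        finally show ?thesis unfolding Suc
          by (simp only: of_nat_le_iff power_Suc mult.assoc flip: of_nat_mult of_nat_power)
      qed simp
      have layers: "real (card (layer E S i)) + (if Suc i < r then real (card (layer E S (Suc i))) else 0)
          \<le> real (card S) * K" if "S \<subseteq> V" "i < r" for S i
      proof (cases "Suc i < r")
        case True
        have "real (card (layer E S i)) + real (card (layer E S (Suc i)))
            \<le> real (card S) * (real \<Delta> ^ i + real \<Delta> ^ Suc i)"
          using layer_pow[OF that(1), of i] layer_pow[OF that(1), of "Suc i"]
          by (simp add: distrib_left del: layer.simps)
        also have "\<dots> \<le> real (card S) * K"
        proof (rule mult_left_mono)
          have "real \<Delta> ^ i * 3 \<le> real \<Delta> ^ i * real \<Delta>"
            using \<Delta> by (intro mult_left_mono) auto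
          then have "real \<Delta> ^ i + real \<Delta> ^ Suc i \<le> 4/3 * real \<Delta> ^ Suc i" by (simp add: mult.commute)
          also have "\<dots> \<le> K"
            unfolding K_def using \<Delta> True by (intro mult_left_mono power_increasing) auto
          finally show "real \<Delta> ^ i + real \<Delta> ^ Suc i \<le> K" .
        qed simp
        finally show ?thesis using True by (simp del: layer.simps)
      next
        case False
        then have i: "i = r - 1" using that(2) by simp
        have "real (card (layer E S i)) \<le> real (card S) * real \<Delta> ^ (r - 1)"
          using layer_pow[OF that(1), of i] i by simp
        also have "\<dots> \<le> real (card S) * K" unfolding K_def by (intro mult_left_mono) auto
        finally show ?thesis using False by simp
      qed
      have "real (bandwidth V E) \<le> n / real r + (3/2) * n / L + 3 * s * L / (3/2) * K"
        using r layers by (intro main) (auto simp: K_def simp del: layer.simps)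
      also have "n / real r \<le> n / (L / 3)" using r L n by (intro divide_left_mono) auto
      also have "3 * s * L / (3/2) * K \<le> (3/2) * n / L"
      proof -
        \<comment> \<open>The cube root of n/s, so that s X^3 = n. One factor X bounds the layers;
          the other two absorb L^2 by 4L \<le> 3X.\<close>
        define X where "X = real \<Delta> powr (L / 3)"
        have "3 powr (L / 3) \<le> X" unfolding X_def using \<Delta> L by (intro powr_mono2) auto
        then have X: "4 * L \<le> 3 * X" using le_three_powr[OF L] by linarith
        have "real \<Delta> ^ (r - 1) = real \<Delta> powr real (r - 1)"
          using \<Delta> by (simp add: powr_realpow)
        also have "\<dots> \<le> X"
          unfolding X_def using \<Delta> r by (intro powr_mono) (auto simp: of_nat_diff)
        finally have "K \<le> 4/3 * X" by (simp add: K_def)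
        then have "3 * s * L / (3/2) * K \<le> 3 * s * L / (3/2) * (4/3 * X)"
          using s L by (intro mult_left_mono) auto
        also have "\<dots> = s * X * (8 * L\<^sup>2) / (3 * L)" using L by (simp add: power2_eq_square)
        also have "\<dots> \<le> s * X * (9/2 * X\<^sup>2) / (3 * L)"
        proof -
          have "(4 * L)\<^sup>2 \<le> (3 * X)\<^sup>2" using X L by (intro power_mono) auto
          then have "8 * L\<^sup>2 \<le> 9/2 * X\<^sup>2" by (simp add: power_mult_distrib)
          then show ?thesis using s L by (intro divide_right_mono mult_left_mono) (auto simp: X_def)
        qed
        also have "\<dots> = (3/2) * (s * (X * X * X)) / L" by (simp add: power2_eq_square)
        also have "X * X * X = real \<Delta> powr L" by (simp add: X_def flip: powr_add)
        finally show ?thesis by (simp flip: n_eq)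
      qed
      also have "n / (L / 3) + (3/2) * n / L + (3/2) * n / L = 6 * n / L"
        using L_pos by (simp add: field_simps)
      finally show ?thesis by simp
    qed
  qed
  then show "real (bandwidth V E) \<le> 6 * real (card V) /
       log (real \<Delta>) (real (card V) / real (separation_number V E))"
    unfolding L_def n_def s_def .
qed

end
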